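(* Let $\mathcal X\subset\mathbb R^n$ be closed and convex, $A\in\mathbb R^{m\times n}$, $b\in\mathbb R^m$, $\beta\ge0$, and let $f=h+g$ where $h\in\mathcal S^{1,1}_{\mu,L}(\mathcal X)$ with $0\le\mu\le L<\infty$ and $g\in\mathcal S^0_0(\mathcal X)$. Let $(x^*,\lambda^* )$ be a KKT point of $\min_{x\in\mathcal X}f(x)$ s.t. $Ax=b$. Let $\theta_0=1$, $\gamma_0>0$, $x_0,v_0\in\mathcal X$, $\lambda_0\in\mathbb R^m$, let $\alpha_k>0$, and let the sequences satisfy, for all $k\in\mathbb N$, $$\frac{\theta_{k+1}-\theta_k}{\alpha_k}=-\theta_{k+1},\qquad\frac{\gamma_{k+1}-\gamma_k}{\alpha_k}=\mu_\beta-\gamma_{k+1},$$ and the corrected explicit scheme $$\theta_k\frac{\lambda_{k+1}-\lambda_k}{\alpha_k}=Av_{k+1}-b,\qquad\frac{y_k-x_k}{\alpha_k}=v_k-y_k,$$ $$\gamma_k\frac{v_{k+1}-v_k}{\alpha_k}\in\mu_\beta(y_k-v_{k+1})-\big(\nabla h_\beta(y_k)+\partial g(v_{k+1})+N_{\mathcal X}(v_{k+1})+A^\top\widehat\lambda_k\big),\qquad\frac{x_{k+1}-x_k}{\alpha_k}=v_{k+1}-x_{k+1},$$ where $\widehat\lambda_k=\lambda_k+\frac{\alpha_k}{\theta_k}(Av_k-b)$. Define $$\mathcal E_k=\mathcal L_\beta(x_k,\lambda^* )-\mathcal L_\beta(x^*,\lambda_k)+\frac{\gamma_k}2\|v_k-x^*\|^2+\frac{\theta_k}2\|\lambda_k-\lambda^*\|^2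 .$$ Then $\{(x_k,y_k,v_k)\}\subset\mathcal X\times\mathcal X\times\mathcal X$, and if $(L_\beta+\|A\|^2)\alpha_k^2=\gamma_k\theta_k$ for all $k$, then $$\mathcal E_{k+1}-\mathcal E_k\le-\alpha_k\mathcal E_{k+1}\quad\text{for all }k\in\mathbb N.$$ Moreover, in that case, for all $k\in\mathbb N$, $$\|Ax_k-b\|\le\theta_k\mathcal R_0,\qquad 0\le\mathcal L(x_k,\lambda^* )-\mathcal L(x^*,\lambda_k)\le\theta_k\mathcal E_0,\qquad |f(x_k)-f(x^* )|\le\theta_k\big(\mathcal E_0+\mathcal R_0\|\lambda^*\|\big),$$ where $\mathcal R_0=\sqrt{2\mathcal E_0}+\|\lambda_0-\lambda^*\|+\|Ax_0-b\|$ and $$\theta_k\le\min\left\{\frac{Q}{\sqrt{\gamma_0}\,k+Q},\ \frac{Q^2}{(\sqrt{\gamma_{\min}}\,k+Q)^2}\right\},\qquad Q=3\sqrt{L_\beta+\|A\|^2}+\sqrt{\gamma_{\max}},$$ with $\gamma_{\min}=\min\{\mu_\beta,\gamma_0\}$ and $\gamma_{\max}=\max\{\mu_\beta,\gamma_0\}$.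
   Context: $\|\cdot\|$ is the Euclidean norm on vectors and $\|A\|$ the spectral norm. $\mathcal S^0_\mu(\mathcal X)$ ($\mu\ge0$) is the class of proper, closed, convex functions $g:\mathbb R^n\to\mathbb R\cup\{+\infty\}$ with $g(y)\ge g(x)+\langle p,y-x\rangle+\frac\mu2\|y-x\|^2$ for all $x,y\in\mathcal X$ and $p\in\partial g(x)$ ($\partial g$ is the convex subdifferential). $\mathcal S^{1,1}_{\mu,L}(\mathcal X)$ is the class of continuously differentiable functions $h$ in $\mathcal S^0_\mu(\mathcal X)$ with $\langle\nabla h(x)-\nabla h(y),x-y\rangle\le L\|x-y\|^2$ for all $x,y\in\mathcal X$. Standing assumptions: the domain of $f$ meets $\mathcal X$, $b\in A\mathcal X$, and a KKT point exists. Notation: $f_\beta(x)=f(x)+\frac\beta2\|Ax-b\|^2$, $h_\beta(x)=h(x)+\frac\beta2\|Ax-b\|^2$; $\mathcal L_\beta(x,\lambda)=f_\beta(x)+\delta_{\mathcal X}(x)+\langle\lambda,Ax-b\rangle$ with $\delta_{\mathcal X}$ the indicator function ($0$ on $\mathcal X$, $+\infty$ elsewhere); $\mathcal L=\mathcal L_0$. $N_{\mathcal X}(x)=\{y:\langle y,z-x\rangle\le0\ \forall z\in\mathcal X\}$ for $x\in\mathcal X$, and $N_{\mathcal X}(x)=\emptyset$ for $x\notin\mathcal X$. $\mu_\beta=\mu+\beta\sigma_{\min}^2(A)$, where $\sigma_{\min}^2(A)$ is the smallest eigenvalue of $A^\top A$ (so $\sigma_{\min}(A)>0$ means full column rank),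 and $L_\beta=L+\beta\|A\|^2$. A KKT point $(x^*,\lambda^* )$ satisfies $x^*\in\mathcal X$, $Ax^*=b$ and $0\in\partial f(x^* )+N_{\mathcal X}(x^* )+A^\top\lambda^*$; it is a saddle point: $\mathcal L(x^*,\lambda)\le\mathcal L(x^*,\lambda^* )\le\mathcal L(x,\lambda^* )$ for all $x,\lambda$. Convention: since $f$ may take the value $+\infty$, inequalities are read in $(-\infty,+\infty]$, and the inequality $\mathcal E_{k+1}-\mathcal E_k\le-\alpha_k\mathcal E_{k+1}$ is understood as $(1+\alpha_k)\mathcal E_{k+1}\le\mathcal E_k$. *)

theory Defs
  imports "HOL-Analysis.Analysis"
begin

text \<open>
  Convex functions with values in \<open>(-\<infinity>, +\<infinity>]\<close> are represented as total \<^typ>\<open>ereal\<close>-valued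
  functions; the value \<open>-\<infinity>\<close> is excluded by properness.
\<close>

definition epi :: "('a \<Rightarrow> ereal) \<Rightarrow> ('a \<times> real) set" where
  "epi g = {(x, r). g x \<le> ereal r}"

definition proper :: "('a \<Rightarrow> ereal) \<Rightarrow> bool" where
  "proper g \<longleftrightarrow> (\<forall>x. g x \<noteq> -\<infinity>) \<and> (\<exists>x. g x \<noteq> \<infinity>)"

text \<open>For proper \<open>g\<close> this set is empty at every point where \<open>g\<close> is \<open>+\<infinity>\<close>.\<close>

definition subdiff :: "('a::real_inner \<Rightarrow> ereal) \<Rightarrow> 'a \<Rightarrow> 'a set" where
  "subdiff g x = {p. \<forall>y. g x + ereal (p \<bullet> (y - x)) \<le> g y}"

definition S0 :: "real \<Rightarrow> 'a::euclidean_space set \<Rightarrow> ('a \<Rightarrow> ereal) set" where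
  "S0 \<mu> X = {g. proper g \<and> closed (epi g) \<and> convex (epi g) \<and>
     (\<forall>x\<in>X. \<forall>y\<in>X. \<forall>p\<in>subdiff g x.
        g x + ereal (p \<bullet> (y - x) + \<mu> / 2 * (norm (y - x))\<^sup>2) \<le> g y)}"

definition grad :: "('a::real_inner \<Rightarrow> real) \<Rightarrow> 'a \<Rightarrow> 'a" where
  "grad h x = (THE d. GDERIV h x :> d)"

text \<open>
  Differentiability is required on the whole space, so these functions are finite everywhere
  and are represented as real-valued functions; only the two quantitative inequalities are
  restricted to \<open>X\<close>.
\<close>

definition S11 :: "real \<Rightarrow> real \<Rightarrow> 'a::euclidean_space set \<Rightarrow> ('a \<Rightarrow> real) set" where
  "S11 \<mu> L X = {h. (\<lambda>x. ereal (h x)) \<in> S0 \<mu> X \<and>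
     (\<forall>x. \<exists>d. GDERIV h x :> d) \<and> continuous_on UNIV (grad h) \<and>
     (\<forall>x\<in>X. \<forall>y\<in>X. (grad h x - grad h y) \<bullet> (x - y) \<le> L * (norm (x - y))\<^sup>2)}"

definition normal_cone :: "'a::real_inner set \<Rightarrow> 'a \<Rightarrow> 'a set" where
  "normal_cone X x = (if x \<in> X then {y. \<forall>z\<in>X. y \<bullet> (z - x) \<le> 0} else {})"

definition ind :: "'a set \<Rightarrow> 'a \<Rightarrow> ereal" where
  "ind X x = (if x \<in> X then 0 else \<infinity>)"

definition spectral_norm :: "real^'n^'m \<Rightarrow> real" where
  "spectral_norm A = onorm ((*v) A)"

definition sigma_min_sq :: "real^'n^'m \<Rightarrow> real" where
  "sigma_min_sq A = (LEAST c. \<exists>u. u \<noteq> 0 \<and> (transpose A ** A) *v u = c *\<^sub>R u)"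

definition mu_beta :: "real^'n^'m \<Rightarrow> real \<Rightarrow> real \<Rightarrow> real" where
  "mu_beta A \<mu> \<beta> = \<mu> + \<beta> * sigma_min_sq A"

definition L_beta :: "real^'n^'m \<Rightarrow> real \<Rightarrow> real \<Rightarrow> real" where
  "L_beta A L \<beta> = L + \<beta> * (spectral_norm A)\<^sup>2"

definition h_beta ::
  "real^'n^'m \<Rightarrow> real^'m \<Rightarrow> (real^'n \<Rightarrow> real) \<Rightarrow> real \<Rightarrow> real^'n \<Rightarrow> real" where
  "h_beta A b h \<beta> x = h x + \<beta> / 2 * (norm (A *v x - b))\<^sup>2"

definition f_beta ::
  "real^'n^'m \<Rightarrow> real^'m \<Rightarrow> (real^'n \<Rightarrow> ereal) \<Rightarrow> real \<Rightarrow> real^'n \<Rightarrow> ereal" where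
  "f_beta A b f \<beta> x = f x + ereal (\<beta> / 2 * (norm (A *v x - b))\<^sup>2)"

definition lagrangian ::
  "(real^'n) set \<Rightarrow> real^'n^'m \<Rightarrow> real^'m \<Rightarrow> (real^'n \<Rightarrow> ereal) \<Rightarrow> real \<Rightarrow> real^'n \<Rightarrow> real^'m \<Rightarrow> ereal"
  where
  "lagrangian X A b f \<beta> x l = f_beta A b f \<beta> x + ind X x + ereal (l \<bullet> (A *v x - b))"

text \<open>The sums of sets are Minkowski sums.\<close>

definition kkt_point ::
  "(real^'n) set \<Rightarrow> real^'n^'m \<Rightarrow> real^'m \<Rightarrow> (real^'n \<Rightarrow> ereal) \<Rightarrow> real^'n \<Rightarrow> real^'m \<Rightarrow> bool" where
  "kkt_point X A b f x l \<longleftrightarrow> x \<in> X \<and> A *v x = b \<and>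
     0 \<in> subdiff f x + normal_cone X x + {transpose A *v l}"

text \<open>Only used for nonnegative arguments.\<close>

definition ereal_sqrt :: "ereal \<Rightarrow> ereal" where
  "ereal_sqrt z = (if z = \<infinity> then \<infinity> else ereal (sqrt (real_of_ereal z)))"

end

theory Submission
  imports Defs
begin

text \<open>
  The proof is a discrete Lyapunov argument. Write \<open>x\<close>, \<open>x'\<close> for consecutive iterates, and so on.
  Multiplying the energy at step \<open>k + 1\<close> by \<open>1 + \<alpha>\<close> restores the old weights,
  since \<open>(1 + \<alpha>) \<theta>' = \<theta>\<close> and \<open>(1 + \<alpha>) \<gamma>' = \<gamma> + \<alpha> \<mu>\<^sub>\<beta>\<close>; the extra \<open>\<alpha> \<mu>\<^sub>\<beta>\<close> is paid for
  by strong convexity. The function value at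
  \<open>x'\<close> is controlled by the descent lemma at \<open>y\<close> for the smooth part and by convexity for the
  nonsmooth part; the gradient at \<open>y\<close> is then eliminated with the inclusion that defines \<open>v'\<close>.
  The choice of the predicted multiplier cancels the terms that are linear in the residual, up to
  \<open>\<alpha>\<^sup>2 / (2 \<theta>) (\<parallel>A (v' - v)\<parallel>\<^sup>2 - \<parallel>A v - b\<parallel>\<^sup>2)\<close>. What remains is at most a multiple of
  \<open>\<parallel>v' - v\<parallel>\<^sup>2\<close>, and the step size rule \<open>(L\<^sub>\<beta> + \<parallel>A\<parallel>\<^sup>2) \<alpha>\<^sup>2 = \<gamma> \<theta>\<close> is what makes its
  coefficient nonpositive. This is lemma \<open>lyapunov_contraction\<close>; its hypotheses on the smooth part
  come from \<open>h_beta_descent\<close> and \<open>h_beta_strong_convexity\<close>.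

  Consequently the energy is at most \<open>\<theta>\<^sub>k \<E>\<^sub>0\<close>. By the saddle point property
  (\<open>kkt_minimizes_lagrangian\<close>) all its summands are nonnegative, so each of them obeys the same bound:
  this gives the estimate for the Lagrangian gap and bounds the multipliers. The difference
  \<open>(A x\<^sub>k - b) / \<theta>\<^sub>k - \<lambda>\<^sub>k\<close> does not depend on \<open>k\<close> (\<open>residual_dual_identity\<close>), so
  bounded multipliers force \<open>\<parallel>A x\<^sub>k - b\<parallel> = O(\<theta>\<^sub>k)\<close>, and the function value estimate
  follows from the other two with the Cauchy-Schwarz inequality. The decay of \<open>\<theta>\<^sub>k\<close> is a matter of the two
  scalar recurrences and the step size rule (\<open>theta_decay\<close>).

  An infinite energy occurs only while \<open>g (x\<^sub>k) = \<infinity>\<close>. Since \<open>g (v\<^sub>k\<^sub>+\<^sub>1)\<close> is always finite,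
  finiteness at one \<open>x\<^sub>k\<close> is inherited by all later ones, and the extended-valued claims reduce to real
  ones or to a right-hand side \<open>+\<infinity>\<close>.
\<close>

section \<open>Extended-valued convex functions and smooth functions\<close>

lemma grad_eqI:
  assumes "GDERIV h x :> d"
  shows "grad h x = d"
  unfolding grad_def
proof (rule the_equality)
  fix e assume e: "GDERIV h x :> e"
  have eq: "(\<lambda>u. u \<bullet> e) = (\<lambda>u. u \<bullet> d)"
    by (rule has_derivative_unique[OF e[unfolded gderiv_def] assms[unfolded gderiv_def]])
  show "e = d"
    by (rule vector_eq_ldot[THEN iffD1], rule allI) (rule fun_cong[OF eq])
qed (rule assms)

lemma S0_not_minf: "g \<in> S0 m X \<Longrightarrow> g z \<noteq> -\<infinity>"
  by (auto simp: S0_def proper_def)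

lemma S0_strong_subgradient:
  assumes "g \<in> S0 \<mu> X" "y \<in> X" "z \<in> X" "p \<in> subdiff g y"
  shows "g y + ereal (p \<bullet> (z - y) + \<mu> / 2 * (norm (z - y))\<^sup>2) \<le> g z"
proof -
  have "\<forall>x\<in>X. \<forall>y\<in>X. \<forall>p\<in>subdiff g x.
      g x + ereal (p \<bullet> (y - x) + \<mu> / 2 * (norm (y - x))\<^sup>2) \<le> g y"
    using assms(1) unfolding S0_def mem_Collect_eq by (elim conjE)
  from bspec[OF bspec[OF bspec[OF this assms(2)] assms(3)] assms(4)] show ?thesis .
qed

lemma S0_convex_combination:
  assumes g: "g \<in> S0 m X" and le: "g u \<le> ereal r" "g w \<le> ereal s"
    and t: "0 \<le> t" "t \<le> 1"
  shows "g ((1 - t) *\<^sub>R u + t *\<^sub>R w) \<le> ereal ((1 - t) * r + t * s)"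
proof -
  have "convex (epi g)" using g by (simp add: S0_def)
  moreover have "(u, r) \<in> epi g" "(w, s) \<in> epi g" using le by (auto simp: epi_def)
  ultimately have "(1 - t) *\<^sub>R (u, r) + t *\<^sub>R (w, s) \<in> epi g"
    using t unfolding convex_alt by blast
  then show ?thesis by (simp add: epi_def)
qed

lemma subdiff_finite:
  assumes "proper g" and "p \<in> subdiff g z"
  shows "g z \<noteq> \<infinity>"
proof
  assume inf: "g z = \<infinity>"
  obtain w where w: "g w \<noteq> \<infinity>" using assms(1) by (auto simp: proper_def)
  have "g z + ereal (p \<bullet> (w - z)) \<le> g w" using assms(2) by (auto simp: subdiff_def)
  with inf w show False by simp
qed

lemma S11D:
  assumes "h \<in> S11 \<mu> L X"
  shows S11_S0: "(\<lambda>z. ereal (h z)) \<in> S0 \<mu> X"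
    and S11_differentiable: "\<exists>d. GDERIV h z :> d"
    and S11_grad_monotone_bound: "x \<in> X \<Longrightarrow> y \<in> X \<Longrightarrow>
      (grad h x - grad h y) \<bullet> (x - y) \<le> L * (norm (x - y))\<^sup>2"
proof -
  have *: "(\<lambda>z. ereal (h z)) \<in> S0 \<mu> X \<and> (\<forall>x. \<exists>d. GDERIV h x :> d) \<and>
     continuous_on UNIV (grad h) \<and>
     (\<forall>x\<in>X. \<forall>y\<in>X. (grad h x - grad h y) \<bullet> (x - y) \<le> L * (norm (x - y))\<^sup>2)"
    using assms unfolding S11_def mem_Collect_eq .
  show "(\<lambda>z. ereal (h z)) \<in> S0 \<mu> X" by (rule conjunct1[OF *])
  show "\<exists>d. GDERIV h z :> d" by (rule spec[OF conjunct1[OF conjunct2[OF *]]])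
  show "(grad h x - grad h y) \<bullet> (x - y) \<le> L * (norm (x - y))\<^sup>2" if "x \<in> X" "y \<in> X"
    by (rule bspec[OF bspec[OF conjunct2[OF conjunct2[OF conjunct2[OF *]]] that(1)] that(2)])
qed

lemma S11_gderiv:
  assumes "h \<in> S11 \<mu> L X"
  shows "GDERIV h z :> grad h z"
proof -
  obtain d where d: "GDERIV h z :> d" using S11_differentiable[OF assms] ..
  then show ?thesis by (simp only: grad_eqI[OF d])
qed

lemma gderiv_line:
  assumes "GDERIV h (y + t *\<^sub>R d) :> e"
  shows "((\<lambda>s. h (y + s *\<^sub>R d)) has_real_derivative e \<bullet> d) (at t)"
proof -
  have 1: "((\<lambda>s. y + s *\<^sub>R d) has_derivative (\<lambda>s. s *\<^sub>R d)) (at t)"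
    by (auto intro!: derivative_eq_intros)
  have 2: "(h has_derivative (\<lambda>u. u \<bullet> e)) (at (y + t *\<^sub>R d))"
    using assms by (simp add: gderiv_def)
  have "((\<lambda>s. h (y + s *\<^sub>R d)) has_derivative (\<lambda>s. (s *\<^sub>R d) \<bullet> e)) (at t)"
    using has_derivative_compose[OF 1 2] .
  moreover have "(\<lambda>s. (s *\<^sub>R d) \<bullet> e) = (*) (e \<bullet> d)"
    by (auto simp: inner_commute)
  ultimately show ?thesis by (simp add: has_field_derivative_def)
qed

text \<open>
  Restrict \<open>h\<close> to the line through \<open>y\<close> and \<open>z\<close>; a convex function of one real variable lies above
  its tangents.
\<close>

lemma S11_grad_in_subdiff:
  assumes h: "h \<in> S11 \<mu> L X"
  shows "grad h y \<in> subdiff (\<lambda>z. ereal (h z)) y"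
proof -
  have "h y + grad h y \<bullet> (z - y) \<le> h z" for z
  proof -
    let ?p = "\<lambda>s. h (y + s *\<^sub>R (z - y))"
    have S: "(\<lambda>z. ereal (h z)) \<in> S0 \<mu> X" using h by (rule S11_S0)
    have cv: "convex_on UNIV ?p"
    proof (intro convex_onI)
      fix t a c :: real assume t: "0 < t" "t < 1"
      have eq: "y + ((1 - t) *\<^sub>R a + t *\<^sub>R c) *\<^sub>R (z - y)
          = (1 - t) *\<^sub>R (y + a *\<^sub>R (z - y)) + t *\<^sub>R (y + c *\<^sub>R (z - y))"
        by (simp add: algebra_simps)
      show "?p ((1 - t) *\<^sub>R a + t *\<^sub>R c) \<le> (1 - t) * ?p a + t * ?p c"
        unfolding eq
        using S0_convex_combination[OF S, of "y + a *\<^sub>R (z - y)" "?p a"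
            "y + c *\<^sub>R (z - y)" "?p c" t] t
        by simp
    qed simp
    have D: "(?p has_real_derivative grad h y \<bullet> (z - y)) (at 0)"
      using gderiv_line[of h y 0 "z - y"] S11_gderiv[OF h] by simp
    have "?p 1 - ?p 0 \<ge> grad h y \<bullet> (z - y) * (1 - 0)"
      by (rule convex_on_imp_above_tangent[OF cv]) (use D in auto)
    then show ?thesis by simp
  qed
  then show ?thesis by (simp add: subdiff_def)
qed

lemma S11_strong_convexity:
  assumes h: "h \<in> S11 \<mu> L X" and yz: "y \<in> X" "z \<in> X"
  shows "h y + grad h y \<bullet> (z - y) + \<mu> / 2 * (norm (z - y))\<^sup>2 \<le> h z"
  using S0_strong_subgradient[OF S11_S0[OF h] yz S11_grad_in_subdiff[OF h]] by simp

text \<open>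
  The descent lemma from the one-sided bound on the gradient difference alone: along the segment
  from \<open>y\<close> to \<open>z\<close>, which stays in the convex set \<open>X\<close>, the difference of \<open>h\<close> and the
  quadratic majorant has nonpositive derivative.
\<close>

lemma S11_descent:
  assumes h: "h \<in> S11 \<mu> L X" and X: "convex X" and yz: "y \<in> X" "z \<in> X"
  shows "h z \<le> h y + grad h y \<bullet> (z - y) + L / 2 * (norm (z - y))\<^sup>2"
proof -
  define d where "d = z - y"
  define q where "q t = h (y + t *\<^sub>R d) - t * (grad h y \<bullet> d) - L / 2 * t\<^sup>2 * (norm d)\<^sup>2" for t
  have "q 1 \<le> q 0"
  proof (rule DERIV_nonpos_imp_nonincreasing[of 0 1 q])
    fix t :: real assume t: "0 \<le> t" "t \<le> 1"
    have D1: "((\<lambda>s. h (y + s *\<^sub>R d)) has_real_derivative grad h (y + t *\<^sub>R d) \<bullet> d) (at t)"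
      by (rule gderiv_line[OF S11_gderiv[OF h]])
    have D: "(q has_real_derivative
        grad h (y + t *\<^sub>R d) \<bullet> d - grad h y \<bullet> d - L * t * (norm d)\<^sup>2) (at t)"
      unfolding q_def
      by (rule derivative_eq_intros D1 refl)+ simp
    have "grad h (y + t *\<^sub>R d) \<bullet> d - grad h y \<bullet> d - L * t * (norm d)\<^sup>2 \<le> 0"
    \<comment> \<open>The gradient bound yields \<open>t\<close> times the claim, which says nothing at \<open>t = 0\<close>.\<close>
    proof (cases "t = 0")
      case False
      have "y + t *\<^sub>R d = (1 - t) *\<^sub>R y + t *\<^sub>R z" by (simp add: d_def algebra_simps)
      then have "y + t *\<^sub>R d \<in> X" using X yz t unfolding convex_alt by metis
      then have "(grad h (y + t *\<^sub>R d) - grad h y) \<bullet> (y + t *\<^sub>R d - y)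
          \<le> L * (norm (y + t *\<^sub>R d - y))\<^sup>2"
        by (rule S11_grad_monotone_bound[OF h _ yz(1)])
      then have "t * ((grad h (y + t *\<^sub>R d) - grad h y) \<bullet> d) \<le> L * (t * norm d)\<^sup>2"
        using t by simp
      also have "L * (t * norm d)\<^sup>2 = t * (L * t * (norm d)\<^sup>2)"
        by (simp add: power2_eq_square)
      finally have "t * (grad h (y + t *\<^sub>R d) \<bullet> d - grad h y \<bullet> d) \<le> t * (L * t * (norm d)\<^sup>2)"
        by (simp only: inner_diff_left)
      then show ?thesis using t False by simp
    qed simp
    with D show "\<exists>y. (q has_real_derivative y) (at t) \<and> y \<le> 0" by blast
  qed simp
  then show ?thesis by (simp add: q_def d_def)
qed

section \<open>Extreme singular values and the penalised smooth part\<close>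

lemma gram_inner:
  fixes A :: "real^'n^'m"
  shows "((transpose A ** A) *v u) \<bullet> w = (A *v u) \<bullet> (A *v w)"
  by (simp add: matrix_vector_mul_assoc[symmetric] transpose_matrix_vector dot_lmul_matrix)

lemma transpose_inner:
  fixes A :: "real^'n^'m"
  shows "(transpose A *v l) \<bullet> w = l \<bullet> (A *v w)"
  by (simp add: transpose_matrix_vector dot_lmul_matrix)

text \<open>
  The least eigenvalue of \<open>A\<^sup>T A\<close> is the minimum \<open>c\<close> of \<open>\<parallel>A u\<parallel>\<^sup>2\<close> over the unit sphere. The
  minimum is attained, at \<open>u\<close> say, by compactness, and every eigenvalue is at least \<open>c\<close>. That \<open>c\<close> is
  itself an eigenvalue is the first order condition at \<open>u\<close>: moving from \<open>u\<close> in the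
  direction \<open>r = A\<^sup>T A u - c u\<close> changes \<open>\<parallel>A w\<parallel>\<^sup>2 - c \<parallel>w\<parallel>\<^sup>2\<close>, which is minimal (zero) at
  \<open>u\<close>, at the rate \<open>2 \<parallel>r\<parallel>\<^sup>2\<close>; hence \<open>r = 0\<close>.
\<close>

lemma sigma_min_sq_rayleigh:
  fixes A :: "real^'n^'m"
  shows "0 \<le> sigma_min_sq A" and "sigma_min_sq A * (norm w)\<^sup>2 \<le> (norm (A *v w))\<^sup>2"
proof -
  obtain u where u: "norm u = 1"
    and min: "\<And>w. norm w = 1 \<Longrightarrow> (norm (A *v u))\<^sup>2 \<le> (norm (A *v w))\<^sup>2"
  proof -
    have "continuous_on (sphere 0 1) (\<lambda>u. (norm (A *v u))\<^sup>2)"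
      by (intro continuous_intros matrix_vector_mult_linear_continuous_on)
    moreover have "compact (sphere (0::real^'n) 1)" "sphere (0::real^'n) 1 \<noteq> {}" by auto
    ultimately obtain u where "u \<in> sphere 0 1"
      "\<forall>w\<in>sphere 0 1. (norm (A *v u))\<^sup>2 \<le> (norm (A *v w))\<^sup>2"
      using continuous_attains_inf by blast
    then show ?thesis using that by simp
  qed
  define c where "c = (norm (A *v u))\<^sup>2"
  have ray: "c * (norm w)\<^sup>2 \<le> (norm (A *v w))\<^sup>2" for w
  proof (cases "w = 0")
    case False
    have "c \<le> (norm (A *v (w /\<^sub>R norm w)))\<^sup>2"
      unfolding c_def using False by (intro min) simp
    also have "\<dots> = (norm (A *v w))\<^sup>2 / (norm w)\<^sup>2"
      by (simp add: matrix_vector_mult_scaleR power_mult_distrib divide_inverse power_inverse mult.commute)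
    finally show ?thesis using False by (simp add: field_simps)
  qed simp
  define r where "r = (transpose A ** A) *v u - c *\<^sub>R u"
  define K where "K = (norm (A *v r))\<^sup>2 - c * (norm r)\<^sup>2"
  have K: "0 \<le> K" using ray[of r] by (simp add: K_def)
  have r2: "(A *v u) \<bullet> (A *v r) - c * (u \<bullet> r) = (norm r)\<^sup>2"
    unfolding gram_inner[symmetric] by (simp add: r_def power2_norm_eq_inner inner_diff_left)
  have quad: "0 \<le> 2 * t * (norm r)\<^sup>2 + t\<^sup>2 * K" for t
  proof -
    have "c * (norm (u + t *\<^sub>R r))\<^sup>2 \<le> (norm (A *v (u + t *\<^sub>R r)))\<^sup>2" by (rule ray)
    moreover have "(norm (u + t *\<^sub>R r))\<^sup>2 = 1 + 2 * t * (u \<bullet> r) + t\<^sup>2 * (norm r)\<^sup>2"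
    proof -
      have "u \<bullet> u = 1" using u by (simp add: norm_eq_1)
      then show ?thesis
        unfolding power2_norm_eq_inner
        by (simp add: inner_add inner_commute algebra_simps power2_eq_square)
    qed
    moreover have "(norm (A *v (u + t *\<^sub>R r)))\<^sup>2
        = c + 2 * t * ((A *v u) \<bullet> (A *v r)) + t\<^sup>2 * (norm (A *v r))\<^sup>2"
      unfolding c_def power2_norm_eq_inner
      by (simp add: matrix_vector_right_distrib matrix_vector_mult_scaleR inner_add
          inner_commute algebra_simps power2_eq_square)
    ultimately show ?thesis
      unfolding r2[symmetric] K_def by (simp add: algebra_simps)
  qed
  have "r = 0"
  proof (rule ccontr)
    assume "r \<noteq> 0"
    \<comment> \<open>Any small negative parameter makes \<open>quad\<close> fail; \<open>- s\<close> avoids dividing by \<open>K\<close>, which may be zero.\<close>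
    define s where "s = (norm r)\<^sup>2 / (K + 1)"
    have s: "0 < s" "(norm r)\<^sup>2 = s * (K + 1)" using \<open>r \<noteq> 0\<close> K by (auto simp: s_def)
    have "0 \<le> 2 * (- s) * (s * (K + 1)) + (- s)\<^sup>2 * K" using quad[of "- s"] s(2) by simp
    also have "\<dots> = - (s\<^sup>2 * (K + 2))" by (simp add: algebra_simps power2_eq_square)
    finally show False using s(1) K by (simp add: zero_less_mult_iff not_less[symmetric])
  qed
  then have eig: "\<exists>u. u \<noteq> 0 \<and> (transpose A ** A) *v u = c *\<^sub>R u"
    using u by (intro exI[of _ u]) (auto simp: r_def)
  have "sigma_min_sq A = c"
    unfolding sigma_min_sq_def
  proof (rule Least_equality)
    show "\<exists>u. u \<noteq> 0 \<and> (transpose A ** A) *v u = c *\<^sub>R u" by (rule eig)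
  next
    fix c' assume "\<exists>w. w \<noteq> 0 \<and> (transpose A ** A) *v w = c' *\<^sub>R w"
    then obtain w where w: "w \<noteq> 0" "(transpose A ** A) *v w = c' *\<^sub>R w" by blast
    have "c' * (norm w)\<^sup>2 = (norm (A *v w))\<^sup>2"
      using gram_inner[of A w w] w(2) by (simp add: power2_norm_eq_inner)
    then have "c * (norm w)\<^sup>2 \<le> c' * (norm w)\<^sup>2" using ray[of w] by simp
    then show "c \<le> c'" using w(1) by (simp add: mult_le_cancel_right)
  qed
  then show "0 \<le> sigma_min_sq A" "sigma_min_sq A * (norm w)\<^sup>2 \<le> (norm (A *v w))\<^sup>2"
    using ray by (simp_all add: c_def)
qed

lemma spectral_norm_bound:
  fixes A :: "real^'n^'m"
  shows "norm (A *v w) \<le> spectral_norm A * norm w"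
  unfolding spectral_norm_def by (rule onorm) simp

lemma penalty_expansion:
  fixes A :: "real^'n^'m"
  shows "(norm (A *v z - b))\<^sup>2 = (norm (A *v y - b))\<^sup>2
    + 2 * ((transpose A *v (A *v y - b)) \<bullet> (z - y)) + (norm (A *v (z - y)))\<^sup>2"
  unfolding transpose_inner power2_norm_eq_inner
  by (simp add: matrix_vector_mult_diff_distrib inner_diff inner_commute algebra_simps)

lemma grad_h_beta:
  fixes A :: "real^'n^'m"
  assumes h: "h \<in> S11 \<mu> L X"
  shows "grad (h_beta A b h \<beta>) y = grad h y + \<beta> *\<^sub>R (transpose A *v (A *v y - b))"
proof (rule grad_eqI)
  have "(h has_derivative (\<lambda>u. u \<bullet> grad h y)) (at y)"
    using S11_gderiv[OF h] by (simp add: gderiv_def)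
  moreover have "((\<lambda>z. (A *v z - b) \<bullet> (A *v z - b)) has_derivative
      (\<lambda>u. (A *v y - b) \<bullet> (A *v u) + (A *v u) \<bullet> (A *v y - b))) (at y)"
    by (auto intro!: derivative_eq_intros bounded_linear_imp_has_derivative)
  ultimately have "((\<lambda>z. h z + \<beta> / 2 * ((A *v z - b) \<bullet> (A *v z - b))) has_derivative
      (\<lambda>u. u \<bullet> grad h y + \<beta> / 2 * ((A *v y - b) \<bullet> (A *v u) + (A *v u) \<bullet> (A *v y - b)))) (at y)"
    by (intro has_derivative_add has_derivative_mult_right)
  moreover have "u \<bullet> grad h y + \<beta> / 2 * ((A *v y - b) \<bullet> (A *v u) + (A *v u) \<bullet> (A *v y - b))
     = u \<bullet> (grad h y + \<beta> *\<^sub>R (transpose A *v (A *v y - b)))" for u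
    using transpose_inner[of A "A *v y - b" u]
    by (simp only: inner_add_right inner_scaleR_right inner_commute[of u "transpose A *v _"]
        inner_commute[of "A *v u" "A *v y - b"]) simp
  ultimately show "GDERIV (h_beta A b h \<beta>) y :> grad h y + \<beta> *\<^sub>R (transpose A *v (A *v y - b))"
    unfolding gderiv_def h_beta_def[abs_def] power2_norm_eq_inner by simp
qed

lemma h_beta_strong_convexity:
  fixes A :: "real^'n^'m"
  assumes h: "h \<in> S11 \<mu> L X" and beta: "0 \<le> \<beta>" and yz: "y \<in> X" "z \<in> X"
  shows "h_beta A b h \<beta> y + grad (h_beta A b h \<beta>) y \<bullet> (z - y)
    + mu_beta A \<mu> \<beta> / 2 * (norm (z - y))\<^sup>2 \<le> h_beta A b h \<beta> z"
proof -
  have "\<beta> / 2 * (sigma_min_sq A * (norm (z - y))\<^sup>2) \<le> \<beta> / 2 * (norm (A *v (z - y)))\<^sup>2"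
    using beta by (intro mult_left_mono sigma_min_sq_rayleigh(2)) simp
  moreover define q where "q = transpose A *v (A *v y - b)"
  ultimately show ?thesis
    using S11_strong_convexity[OF h yz]
    unfolding grad_h_beta[OF h] h_beta_def mu_beta_def penalty_expansion[of A z b y]
      q_def[symmetric] inner_add_left inner_scaleR_left
    by (simp add: distrib_left distrib_right add_divide_distrib mult.assoc)
qed

lemma h_beta_descent:
  fixes A :: "real^'n^'m"
  assumes h: "h \<in> S11 \<mu> L X" and X: "convex X" and beta: "0 \<le> \<beta>" and yz: "y \<in> X" "z \<in> X"
  shows "h_beta A b h \<beta> z \<le> h_beta A b h \<beta> y + grad (h_beta A b h \<beta>) y \<bullet> (z - y)
    + L_beta A L \<beta> / 2 * (norm (z - y))\<^sup>2"
proof -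
  have "(norm (A *v (z - y)))\<^sup>2 \<le> (spectral_norm A)\<^sup>2 * (norm (z - y))\<^sup>2"
    using power_mono[OF spectral_norm_bound[of A "z - y"], of 2] by (simp add: power_mult_distrib)
  then have "\<beta> / 2 * (norm (A *v (z - y)))\<^sup>2 \<le> \<beta> / 2 * ((spectral_norm A)\<^sup>2 * (norm (z - y))\<^sup>2)"
    using beta by (intro mult_left_mono) auto
  moreover define q where "q = transpose A *v (A *v y - b)"
  ultimately show ?thesis
    using S11_descent[OF h X yz]
    unfolding grad_h_beta[OF h] h_beta_def L_beta_def penalty_expansion[of A z b y]
      q_def[symmetric] inner_add_left inner_scaleR_left
    by (simp add: distrib_left distrib_right add_divide_distrib mult.assoc)
qed

section \<open>One step of the scheme\<close>

text \<open>
  Both updates of the form \<open>(z - u) / a = w - z\<close> are implicit averages: \<open>z\<close> is the convex combination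
  of \<open>u\<close> and \<open>w\<close> with weights \<open>1 / (1 + a)\<close> and \<open>a / (1 + a)\<close>.
\<close>

lemma convex_step_in:
  assumes X: "convex X" and a: "0 < a" and step: "(1 + a) *\<^sub>R z = u + a *\<^sub>R w"
    and uw: "u \<in> X" "w \<in> X"
  shows "z \<in> X"
proof -
  have "z = (1 / (1 + a)) *\<^sub>R ((1 + a) *\<^sub>R z)" using a by simp
  also have "\<dots> = (1 / (1 + a)) *\<^sub>R u + (a / (1 + a)) *\<^sub>R w"
    unfolding step by (simp add: scaleR_right_distrib)
  finally have z: "z = (1 / (1 + a)) *\<^sub>R u + (a / (1 + a)) *\<^sub>R w" .
  show ?thesis unfolding z
    by (rule convexD[OF X uw]) (use a in \<open>simp_all add: divide_simps\<close>)
qed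

lemma S0_convex_step:
  assumes g: "g \<in> S0 m X" and a: "0 < a" and step: "(1 + a) *\<^sub>R z = u + a *\<^sub>R w"
    and le: "g u \<le> ereal r" "g w \<le> ereal s"
  shows "g z \<le> ereal ((r + a * s) / (1 + a))"
proof -
  let ?t = "a / (1 + a)"
  have t: "0 \<le> ?t" "?t \<le> 1" "1 - ?t = 1 / (1 + a)" using a by (simp_all add: field_simps)
  have "z = (1 / (1 + a)) *\<^sub>R ((1 + a) *\<^sub>R z)" using a by simp
  also have "\<dots> = (1 - ?t) *\<^sub>R u + ?t *\<^sub>R w"
    unfolding step t(3) by (simp add: scaleR_right_distrib)
  finally have z: "z = (1 - ?t) *\<^sub>R u + ?t *\<^sub>R w" .
  have "g z \<le> ereal ((1 - ?t) * r + ?t * s)"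
    unfolding z by (rule S0_convex_combination[OF g le t(1,2)])
  also have "(1 - ?t) * r + ?t * s = (r + a * s) / (1 + a)"
    unfolding t(3) by (simp add: add_divide_distrib)
  finally show ?thesis .
qed

text \<open>
  Dividing the update of \<open>x\<close> by \<open>\<theta> k\<close> gives that \<open>(A *v x k - b) / \<theta> k\<close> and \<open>l k\<close> have the same
  increments. A bound on the multipliers therefore makes the residual \<open>O(\<theta>)\<close>; the penalty term of
  the energy, present only for \<open>\<beta> > 0\<close>, would give no more than \<open>O(sqrt \<theta>)\<close>.
\<close>

lemma residual_dual_identity:
  fixes A :: "real^'n^'m" and x v :: "nat \<Rightarrow> real^'n" and l :: "nat \<Rightarrow> real^'m"
  assumes th0: "\<theta> 0 = 1" and al: "\<And>k. 0 < \<alpha> k"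
    and th: "\<And>k. (1 + \<alpha> k) * \<theta> (Suc k) = \<theta> k"
    and x: "\<And>k. (1 + \<alpha> k) *\<^sub>R x (Suc k) = x k + \<alpha> k *\<^sub>R v (Suc k)"
    and l: "\<And>k. \<theta> k *\<^sub>R (l (Suc k) - l k) = \<alpha> k *\<^sub>R (A *v v (Suc k) - b)"
  shows "A *v x k - b = \<theta> k *\<^sub>R (l k - l 0 + (A *v x 0 - b))"
proof (induction k)
  case (Suc k)
  have "(1 + \<alpha> k) *\<^sub>R (A *v x (Suc k)) = A *v x k + \<alpha> k *\<^sub>R (A *v v (Suc k))"
    using arg_cong[OF x[of k], of "\<lambda>z. A *v z"]
    by (simp only: matrix_vector_right_distrib matrix_vector_mult_scaleR)
  then have "(1 + \<alpha> k) *\<^sub>R (A *v x (Suc k) - b) = (A *v x k - b) + \<alpha> k *\<^sub>R (A *v v (Suc k) - b)"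
    by (simp add: algebra_simps)
  also have "\<dots> = \<theta> k *\<^sub>R (l k - l 0 + (A *v x 0 - b)) + \<theta> k *\<^sub>R (l (Suc k) - l k)"
    unfolding Suc l ..
  also have "\<dots> = \<theta> k *\<^sub>R (l (Suc k) - l 0 + (A *v x 0 - b))"
    by (simp add: algebra_simps)
  also have "\<dots> = (1 + \<alpha> k) *\<^sub>R (\<theta> (Suc k) *\<^sub>R (l (Suc k) - l 0 + (A *v x 0 - b)))"
    by (simp only: scaleR_scaleR th)
  finally show ?case using al[of k] by (simp only: scaleR_cancel_left) auto
qed (simp add: th0)

text \<open>
  Test \<open>0 = p + n + A\<^sup>T ls\<close> with \<open>z - xs\<close>: the normal vector contributes a nonpositive amount, so
  the subgradient inequality for \<open>f\<close> loses at most \<open>ls \<bullet> (A *v z - b)\<close>.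
\<close>

lemma kkt_minimizes_lagrangian:
  assumes kkt: "kkt_point X A b f xs ls" and z: "z \<in> X"
  shows "f xs \<le> f z + ereal (ls \<bullet> (A *v z - b))"
proof -
  obtain p n where p: "p \<in> subdiff f xs" and n: "n \<in> normal_cone X xs"
    and sum: "0 = p + n + transpose A *v ls" and Axs: "A *v xs = b"
    using kkt unfolding kkt_point_def by (auto elim!: set_plus_elim)
  have n': "n \<bullet> (z - xs) \<le> 0" using n z by (auto simp: normal_cone_def split: if_splits)
  have "0 = p \<bullet> (z - xs) + n \<bullet> (z - xs) + (transpose A *v ls) \<bullet> (z - xs)"
    using arg_cong[OF sum, of "\<lambda>u. u \<bullet> (z - xs)"] by (simp only: inner_add_left inner_zero_left)
  also have "(transpose A *v ls) \<bullet> (z - xs) = ls \<bullet> (A *v z - b)"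
    unfolding transpose_inner matrix_vector_mult_diff_distrib Axs ..
  finally have slope: "0 \<le> p \<bullet> (z - xs) + ls \<bullet> (A *v z - b)" using n' by linarith
  have "f xs + ereal (p \<bullet> (z - xs)) \<le> f z" using p by (simp add: subdiff_def)
  then have "f xs + ereal (p \<bullet> (z - xs)) + ereal (ls \<bullet> (A *v z - b)) \<le> f z + ereal (ls \<bullet> (A *v z - b))"
    by (rule add_right_mono)
  moreover have "f xs \<le> f xs + ereal (p \<bullet> (z - xs) + ls \<bullet> (A *v z - b))"
    using slope by (cases "f xs") auto
  ultimately show ?thesis by (simp add: add.assoc) 
qed

text \<open>
  The contraction is stated for arbitrary real-valued \<open>H\<close> (the penalised smooth part) and \<open>G\<close>, using
  only the inequalities between the points at hand; \<open>d\<close> is the gradient of \<open>H\<close> at \<open>y\<close>,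
  \<open>p\<close> a subgradient of \<open>G\<close> and \<open>n\<close> a normal vector, both at \<open>v'\<close>.

  With \<open>w = v' - v\<close>, four contributions are quadratic. The descent lemma leaves
  \<open>M a\<^sup>2 / 2 \<parallel>w\<parallel>\<^sup>2\<close> at most; the three-point identity for the \<open>v\<close>-update contributes
  \<open>- \<gamma> / 2 \<parallel>w\<parallel>\<^sup>2\<close>; the multiplier update together with the prediction leaves
  \<open>a\<^sup>2 / (2 \<theta>) K\<^sup>2 \<parallel>w\<parallel>\<^sup>2\<close> at most; the strong convexity terms cancel up to
  \<open>- a m / 2 \<parallel>y - v'\<parallel>\<^sup>2\<close>. As \<open>\<theta> \<le> 1\<close>, the step size rule makes the sum nonpositive.
\<close>

lemma lyapunov_contraction:
  fixes A :: "real^'n^'m" and H G :: "real^'n \<Rightarrow> real"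
  assumes a: "0 < a" and th: "0 < \<theta>" "\<theta> \<le> 1" and m: "0 \<le> m" and M: "0 \<le> M"
    and K: "\<And>w. norm (A *v w) \<le> K * norm w"
    and size: "(M + K\<^sup>2) * a\<^sup>2 = \<gamma> * \<theta>"
    and feas: "A *v xs = b"
    and th': "(1 + a) * \<theta>' = \<theta>" and ga': "(1 + a) * \<gamma>' = \<gamma> + a * m"
    and y: "(1 + a) *\<^sub>R y = x + a *\<^sub>R v" and x': "(1 + a) *\<^sub>R x' = x + a *\<^sub>R v'"
    and v': "\<gamma> *\<^sub>R (v' - v) = a *\<^sub>R (m *\<^sub>R (y - v')
          - (d + p + n + transpose A *v (l + (a / \<theta>) *\<^sub>R (A *v v - b))))"
    and l': "\<theta> *\<^sub>R (l' - l) = a *\<^sub>R (A *v v' - b)"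
    and upper: "H x' \<le> H y + d \<bullet> (x' - y) + M / 2 * (norm (x' - y))\<^sup>2"
    and lower: "H y + d \<bullet> (x - y) + m / 2 * (norm (x - y))\<^sup>2 \<le> H x"
    and strong: "H y + d \<bullet> (xs - y) + m / 2 * (norm (xs - y))\<^sup>2 \<le> H xs"
    and conv: "(1 + a) * G x' \<le> G x + a * G v'"
    and sub: "G v' + p \<bullet> (xs - v') \<le> G xs"
    and cone: "n \<bullet> (xs - v') \<le> 0"
  shows "(1 + a) * (H x' + G x' + ls \<bullet> (A *v x' - b) - (H xs + G xs)
        + \<gamma>' / 2 * (norm (v' - xs))\<^sup>2 + \<theta>' / 2 * (norm (l' - ls))\<^sup>2)
    \<le> H x + G x + ls \<bullet> (A *v x - b) - (H xs + G xs)
        + \<gamma> / 2 * (norm (v - xs))\<^sup>2 + \<theta> / 2 * (norm (l - ls))\<^sup>2"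
proof -
  define w where "w = v' - v"
  define r where "r = A *v v - b"
  define r' where "r' = A *v v' - b"
  have r': "r' = A *v (v' - xs)" by (simp add: r'_def feas[symmetric] matrix_vector_mult_diff_distrib)
  have xy: "(1 + a) *\<^sub>R (x' - y) = a *\<^sub>R w" using x' y by (simp add: w_def algebra_simps)
  have xy2: "(1 + a)\<^sup>2 * (norm (x' - y))\<^sup>2 = a\<^sup>2 * (norm w)\<^sup>2"
    using arg_cong[OF xy, of "\<lambda>z. (norm z)\<^sup>2"] by (simp add: power_mult_distrib)
  have split: "(1 + a) * (d \<bullet> (x' - y)) = d \<bullet> (x - y) + a * (d \<bullet> (v' - y))"
  proof -
    have "(1 + a) *\<^sub>R (x' - y) = (x - y) + a *\<^sub>R (v' - y)" using x' by (simp add: algebra_simps)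
    from arg_cong[OF this, of "\<lambda>z. d \<bullet> z"] show ?thesis by (simp add: inner_add_right)
  qed
  \<comment> \<open>The exact factor is \<open>M a\<^sup>2 / (2 (1 + a))\<close>; the surplus \<open>1 / (1 + a)\<close> is given away.\<close>
  have quad: "(1 + a) * (M / 2 * (norm (x' - y))\<^sup>2) \<le> M * a\<^sup>2 / 2 * (norm w)\<^sup>2"
  proof -
    have "(1 + a) * (norm (x' - y))\<^sup>2 \<le> (1 + a)\<^sup>2 * (norm (x' - y))\<^sup>2"
      using a by (intro mult_right_mono) (auto simp: power2_eq_square)
    then have "M / 2 * ((1 + a) * (norm (x' - y))\<^sup>2) \<le> M / 2 * (a\<^sup>2 * (norm w)\<^sup>2)"
      unfolding xy2 using M by (intro mult_left_mono) auto
    then show ?thesis by (simp add: algebra_simps)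
  qed
  have H: "(1 + a) * H x' \<le> H x + a * (H xs + d \<bullet> (v' - xs) - m / 2 * (norm (xs - y))\<^sup>2)
      + M * a\<^sup>2 / 2 * (norm w)\<^sup>2"
  proof -
    have "(1 + a) * H x' \<le> (1 + a) * (H y + d \<bullet> (x' - y) + M / 2 * (norm (x' - y))\<^sup>2)"
      using upper a by (intro mult_left_mono) auto
    also have "\<dots> = H y + d \<bullet> (x - y) + a * (H y + d \<bullet> (v' - y))
        + (1 + a) * (M / 2 * (norm (x' - y))\<^sup>2)"
      using split by (simp add: algebra_simps)
    also have "\<dots> \<le> H x + a * (H xs + d \<bullet> (v' - xs) - m / 2 * (norm (xs - y))\<^sup>2)
      + M * a\<^sup>2 / 2 * (norm w)\<^sup>2"
    proof (intro add_mono quad mult_left_mono)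
      have "0 \<le> m / 2 * (norm (x - y))\<^sup>2" using m by simp
      with lower show "H y + d \<bullet> (x - y) \<le> H x" by linarith
      show "H y + d \<bullet> (v' - y) \<le> H xs + d \<bullet> (v' - xs) - m / 2 * (norm (xs - y))\<^sup>2"
        using strong by (simp add: inner_diff_right)
    qed (use a in auto)
    finally show ?thesis .
  qed
  \<comment> \<open>The inclusion for \<open>v'\<close>, tested with \<open>v' - xs\<close>, eliminates the gradient.\<close>
  have inc: "a * (d \<bullet> (v' - xs)) = a * m * ((y - v') \<bullet> (v' - xs)) - \<gamma> * (w \<bullet> (v' - xs))
      - a * (p \<bullet> (v' - xs)) - a * (n \<bullet> (v' - xs)) - a * (l \<bullet> r') - a\<^sup>2 / \<theta> * (r \<bullet> r')"
  proof -
    define q where "q = transpose A *v (l + (a / \<theta>) *\<^sub>R r)"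
    have q: "q \<bullet> (v' - xs) = l \<bullet> r' + a / \<theta> * (r \<bullet> r')"
      unfolding q_def transpose_inner r' by (simp only: inner_add_left inner_scaleR_left)
    have "\<gamma> * (w \<bullet> (v' - xs)) = a * (m * ((y - v') \<bullet> (v' - xs)) - (d \<bullet> (v' - xs)
        + p \<bullet> (v' - xs) + n \<bullet> (v' - xs) + q \<bullet> (v' - xs)))"
      using arg_cong[OF v', of "\<lambda>z. z \<bullet> (v' - xs)"]
      unfolding w_def[symmetric] r_def[symmetric] q_def[symmetric]
      by (simp only: inner_diff_left[of _ _ "v' - xs"] inner_add_left inner_scaleR_left)
    then show ?thesis unfolding q by (simp add: algebra_simps power2_eq_square)
  qed
  have three1: "w \<bullet> (v' - xs) = ((norm (v' - xs))\<^sup>2 - (norm (v - xs))\<^sup>2 + (norm w)\<^sup>2) / 2"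
    unfolding w_def power2_norm_eq_inner by (simp add: inner_diff inner_commute algebra_simps)
  have three2: "(y - v') \<bullet> (v' - xs)
      = ((norm (xs - y))\<^sup>2 - (norm (v' - xs))\<^sup>2 - (norm (y - v'))\<^sup>2) / 2"
    unfolding power2_norm_eq_inner by (simp add: inner_diff inner_commute algebra_simps)
  have dual: "\<theta> / 2 * (norm (l' - ls))\<^sup>2
      = \<theta> / 2 * (norm (l - ls))\<^sup>2 + a * (r' \<bullet> (l - ls)) + a\<^sup>2 / (2 * \<theta>) * (norm r')\<^sup>2"
  proof -
    have "l' - ls = (l - ls) + (a / \<theta>) *\<^sub>R r'"
    proof -
      have "(1 / \<theta>) *\<^sub>R (\<theta> *\<^sub>R (l' - l)) = (1 / \<theta>) *\<^sub>R (a *\<^sub>R r')" using l' by (simp add: r'_def)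
      then have "l' - l = (a / \<theta>) *\<^sub>R r'" using th by simp
      then show ?thesis by (simp add: algebra_simps)
    qed
    moreover have "(norm (z + c *\<^sub>R r'))\<^sup>2 = (norm z)\<^sup>2 + 2 * c * (r' \<bullet> z) + c\<^sup>2 * (norm r')\<^sup>2"
      for z c
      unfolding power2_norm_eq_inner
      by (simp add: inner_add inner_commute algebra_simps power2_eq_square)
    ultimately have "(norm (l' - ls))\<^sup>2 = (norm (l - ls))\<^sup>2 + 2 * (a / \<theta>) * (r' \<bullet> (l - ls))
        + (a / \<theta>)\<^sup>2 * (norm r')\<^sup>2" by (simp only:)
    then show ?thesis using th by (simp add: field_simps power2_eq_square)
  qed
  have lin: "(1 + a) * (ls \<bullet> (A *v x' - b)) = ls \<bullet> (A *v x - b) + a * (ls \<bullet> r')"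
  proof -
    have "(1 + a) *\<^sub>R (A *v x' - b) = (A *v x - b) + a *\<^sub>R r'"
      using arg_cong[OF x', of "\<lambda>z. A *v z"]
      by (simp add: matrix_vector_right_distrib matrix_vector_mult_scaleR r'_def algebra_simps)
    from arg_cong[OF this, of "\<lambda>z. ls \<bullet> z"] show ?thesis by (simp add: inner_add_right)
  qed
  \<comment> \<open>This is where the prediction of the multiplier pays off: the mixed term comes from the predicted
    multiplier and completes the square of \<open>r' - r = A w\<close>.\<close>
  have gap: "(norm r')\<^sup>2 - 2 * (r \<bullet> r') \<le> K\<^sup>2 * (norm w)\<^sup>2"
  proof -
    have "r' - r = A *v w" by (simp add: r_def r'_def w_def matrix_vector_mult_diff_distrib)
    then have "(norm (r' - r))\<^sup>2 \<le> (K * norm w)\<^sup>2" using K[of w] by (simp add: power_mono)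
    moreover have "(norm (r' - r))\<^sup>2 = (norm r')\<^sup>2 - 2 * (r \<bullet> r') + (norm r)\<^sup>2"
      unfolding power2_norm_eq_inner by (simp add: inner_diff inner_commute algebra_simps)
    ultimately show ?thesis using zero_le_power2[of "norm r"] unfolding power_mult_distrib by linarith
  qed
  have gap': "a\<^sup>2 / (2 * \<theta>) * ((norm r')\<^sup>2 - 2 * (r \<bullet> r')) \<le> a\<^sup>2 / (2 * \<theta>) * (K\<^sup>2 * (norm w)\<^sup>2)"
    using gap th by (intro mult_left_mono) auto
  have absorb: "M * a\<^sup>2 / 2 * (norm w)\<^sup>2 + a\<^sup>2 / (2 * \<theta>) * (K\<^sup>2 * (norm w)\<^sup>2) \<le> \<gamma> / 2 * (norm w)\<^sup>2"
  proof -
    have "\<theta> * (M * a\<^sup>2) \<le> 1 * (M * a\<^sup>2)" using th M by (intro mult_right_mono) auto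
    then have "\<theta> * (M * a\<^sup>2) + K\<^sup>2 * a\<^sup>2 \<le> \<gamma> * \<theta>" using size by (simp add: algebra_simps)
    then have "M * a\<^sup>2 + K\<^sup>2 * a\<^sup>2 / \<theta> \<le> \<gamma>" using th by (simp add: field_simps)
    then have "(M * a\<^sup>2 + K\<^sup>2 * a\<^sup>2 / \<theta>) * ((norm w)\<^sup>2 / 2) \<le> \<gamma> * ((norm w)\<^sup>2 / 2)"
      by (intro mult_right_mono) auto
    then show ?thesis by (simp add: algebra_simps add_divide_distrib)
  qed
  have G: "(1 + a) * G x' - a * (p \<bullet> (v' - xs)) - a * (n \<bullet> (v' - xs)) \<le> G x + a * G xs"
  proof -
    have "a * (G v' + p \<bullet> (xs - v') + n \<bullet> (xs - v')) \<le> a * G xs"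
      using sub cone a by (intro mult_left_mono) auto
    with conv show ?thesis by (simp add: inner_diff_right algebra_simps)
  qed
  have drop: "0 \<le> a * m / 2 * (norm (y - v'))\<^sup>2" using a m by simp
  have ex: "(1 + a) * (H x' + G x' + ls \<bullet> (A *v x' - b) - (H xs + G xs)
        + \<gamma>' / 2 * (norm (v' - xs))\<^sup>2 + \<theta>' / 2 * (norm (l' - ls))\<^sup>2)
     = (1 + a) * H x' + (1 + a) * G x' + (1 + a) * (ls \<bullet> (A *v x' - b)) - (1 + a) * (H xs + G xs)
        + ((1 + a) * \<gamma>') / 2 * (norm (v' - xs))\<^sup>2 + ((1 + a) * \<theta>') / 2 * (norm (l' - ls))\<^sup>2"
    by (simp add: algebra_simps add_divide_distrib)
  have inc': "a * (d \<bullet> (v' - xs))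
     = a * m / 2 * (norm (xs - y))\<^sup>2 - a * m / 2 * (norm (v' - xs))\<^sup>2 - a * m / 2 * (norm (y - v'))\<^sup>2
      - \<gamma> / 2 * (norm (v' - xs))\<^sup>2 + \<gamma> / 2 * (norm (v - xs))\<^sup>2 - \<gamma> / 2 * (norm w)\<^sup>2
      - a * (p \<bullet> (v' - xs)) - a * (n \<bullet> (v' - xs)) - a * (l \<bullet> r') - a\<^sup>2 / \<theta> * (r \<bullet> r')"
    unfolding inc three1 three2 by (simp add: algebra_simps add_divide_distrib diff_divide_distrib)
  have ga: "(\<gamma> + a * m) / 2 * (norm (v' - xs))\<^sup>2
      = \<gamma> / 2 * (norm (v' - xs))\<^sup>2 + a * m / 2 * (norm (v' - xs))\<^sup>2"
    by (simp add: algebra_simps add_divide_distrib)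
  have du: "a * (r' \<bullet> (l - ls)) = a * (l \<bullet> r') - a * (ls \<bullet> r')"
    by (simp add: inner_diff_right inner_commute algebra_simps)
  have gp: "a\<^sup>2 / (2 * \<theta>) * ((norm r')\<^sup>2 - 2 * (r \<bullet> r'))
      = a\<^sup>2 / (2 * \<theta>) * (norm r')\<^sup>2 - a\<^sup>2 / \<theta> * (r \<bullet> r')"
    using th by (simp add: field_simps)
  have H': "(1 + a) * H x' \<le> H x + a * H xs + a * (d \<bullet> (v' - xs)) - a * m / 2 * (norm (xs - y))\<^sup>2
      + M * a\<^sup>2 / 2 * (norm w)\<^sup>2"
    using H by (simp add: algebra_simps)
  have tot: "(1 + a) * (H xs + G xs) = H xs + G xs + a * H xs + a * G xs"
    by (simp add: algebra_simps)
  show ?thesis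
    unfolding ex th' ga' ga dual lin du tot
    using H'[unfolded inc'] gap'[unfolded gp] absorb G drop by linarith
qed

section \<open>Decay of the scaling parameter\<close>

lemma theta_in_unit_interval:
  fixes \<theta> \<alpha> :: "nat \<Rightarrow> real"
  assumes th0: "\<theta> 0 = 1" and al: "\<And>k. 0 < \<alpha> k"
    and th: "\<And>k. (1 + \<alpha> k) * \<theta> (Suc k) = \<theta> k"
  shows "0 < \<theta> k" and "\<theta> k \<le> 1"
proof -
  have pos: "0 < \<theta> k" for k
  proof (induction k)
    case (Suc k)
    have "0 < (1 + \<alpha> k) * \<theta> (Suc k)" using Suc th by simp
    then show ?case using al[of k] by (simp add: zero_less_mult_iff)
  qed (simp add: th0)
  then show "0 < \<theta> k" .
  show "\<theta> k \<le> 1"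
  proof (induction k)
    case (Suc k)
    have "\<theta> (Suc k) \<le> (1 + \<alpha> k) * \<theta> (Suc k)"
      using al[of k] pos[of "Suc k"] by (simp add: algebra_simps)
    with th[of k] Suc show ?case by simp
  qed (simp add: th0)
qed

text \<open>
  Put \<open>q = sqrt D\<close>, so that \<open>(q \<alpha> k)\<^sup>2 = \<gamma> k * \<theta> k\<close>. There are two lower bounds for \<open>\<gamma> k\<close>. From
  \<open>\<gamma> k \<ge> \<gamma> 0 * \<theta> k\<close> one gets \<open>q \<alpha> k \<ge> sqrt (\<gamma> 0) * \<theta> k\<close>, so \<open>1 / \<theta>\<close> grows at least
  by \<open>sqrt (\<gamma> 0) / q\<close> in each step. From \<open>\<gamma> k \<ge> min m (\<gamma> 0) = c\<close> one gets
  \<open>q \<alpha> k \<ge> sqrt c * sqrt (\<theta> k)\<close>, so \<open>1 / sqrt \<theta>\<close> grows at least by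
  \<open>sqrt c / (q (1 + sqrt (1 + \<alpha> k)))\<close>, and the denominator is at most \<open>Q\<close> because
  \<open>q \<alpha> k \<le> sqrt (max m (\<gamma> 0))\<close>. Both inductions below are these statements with the reciprocals
  cleared.
\<close>

lemma theta_decay:
  fixes \<theta> \<gamma> \<alpha> :: "nat \<Rightarrow> real"
  assumes th0: "\<theta> 0 = 1" and ga0: "0 < \<gamma> 0" and m: "0 \<le> m"
    and al: "\<And>k. 0 < \<alpha> k"
    and th: "\<And>k. (1 + \<alpha> k) * \<theta> (Suc k) = \<theta> k"
    and ga: "\<And>k. (1 + \<alpha> k) * \<gamma> (Suc k) = \<gamma> k + \<alpha> k * m"
    and D: "\<And>k. D * (\<alpha> k)\<^sup>2 = \<gamma> k * \<theta> k"
    and Q: "Q = 3 * sqrt D + sqrt (max m (\<gamma> 0))"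
  shows "\<theta> k \<le> Q / (sqrt (\<gamma> 0) * real k + Q)"
    and "\<theta> k \<le> Q\<^sup>2 / (sqrt (min m (\<gamma> 0)) * real k + Q)\<^sup>2"
proof -
  define q where "q = sqrt D"
  have "0 < D * (\<alpha> 0)\<^sup>2" using D[of 0] th0 ga0 by simp
  then have "0 < D" using al[of 0] by (simp add: zero_less_mult_iff)
  then have q: "0 < q" "q\<^sup>2 = D" by (simp_all add: q_def)
  have Qq: "Q = 3 * q + sqrt (max m (\<gamma> 0))" by (simp add: Q q_def)
  have qQ: "q \<le> Q" using q m by (simp add: Qq)
  have Qpos: "0 < Q" using q qQ by simp
  have thpos: "0 < \<theta> k" and th1: "\<theta> k \<le> 1" for k
    using theta_in_unit_interval[of \<theta> \<alpha>] th0 al th by simp_all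
  have galo: "min m (\<gamma> 0) \<le> \<gamma> k" for k
  proof (induction k)
    case (Suc k)
    have "\<alpha> k * min m (\<gamma> 0) \<le> \<alpha> k * m" using al[of k] by (intro mult_left_mono) auto
    with Suc ga[of k] have "(1 + \<alpha> k) * min m (\<gamma> 0) \<le> (1 + \<alpha> k) * \<gamma> (Suc k)"
      by (simp add: distrib_right)
    then show ?case using al[of k] by (simp add: mult_le_cancel_left)
  qed simp
  have gahi: "\<gamma> k \<le> max m (\<gamma> 0)" for k
  proof (induction k)
    case (Suc k)
    have "\<alpha> k * m \<le> \<alpha> k * max m (\<gamma> 0)" using al[of k] by (intro mult_left_mono) auto
    with Suc ga[of k] have "(1 + \<alpha> k) * \<gamma> (Suc k) \<le> (1 + \<alpha> k) * max m (\<gamma> 0)"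
      by (simp add: distrib_right)
    then show ?case using al[of k] by (simp add: mult_le_cancel_left)
  qed simp
  have gath: "\<gamma> 0 * \<theta> k \<le> \<gamma> k" for k
  proof (induction k)
    case (Suc k)
    have "(1 + \<alpha> k) * (\<gamma> 0 * \<theta> (Suc k)) = \<gamma> 0 * ((1 + \<alpha> k) * \<theta> (Suc k))"
      by (rule mult.left_commute)
    also have "\<dots> = \<gamma> 0 * \<theta> k" unfolding th ..
    also have "\<dots> \<le> (1 + \<alpha> k) * \<gamma> (Suc k)" using Suc ga[of k] al[of k] m by (simp add: add_increasing2)
    finally show ?case using al[of k] by (simp add: mult_le_cancel_left)
  qed (simp add: th0)
  have qa: "(q * \<alpha> k)\<^sup>2 = \<gamma> k * \<theta> k" for k using D[of k] q(2) by (simp add: power_mult_distrib)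
  have qa0: "0 \<le> q * \<alpha> k" for k using q(1) al[of k] by simp
  have "(sqrt (\<gamma> 0) * real k + Q) * \<theta> k \<le> Q"
  proof (induction k)
    case (Suc k)
    have "(sqrt (\<gamma> 0) * \<theta> k)\<^sup>2 \<le> (q * \<alpha> k)\<^sup>2"
      unfolding qa using ga0 gath[of k] thpos[of k]
      by (simp add: power_mult_distrib power2_eq_square[of "\<theta> k"] mult_right_mono flip: mult.assoc)
    then have "sqrt (\<gamma> 0) * \<theta> k \<le> q * \<alpha> k" using qa0 by (rule power2_le_imp_le)
    also have "\<dots> \<le> Q * \<alpha> k" using qQ al[of k] by (intro mult_right_mono) auto
    finally have inc: "sqrt (\<gamma> 0) * \<theta> k \<le> Q * \<alpha> k" .
    have "(1 + \<alpha> k) * ((sqrt (\<gamma> 0) * real (Suc k) + Q) * \<theta> (Suc k))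
        = (sqrt (\<gamma> 0) * real (Suc k) + Q) * ((1 + \<alpha> k) * \<theta> (Suc k))"
      by (rule mult.left_commute)
    also have "\<dots> = (sqrt (\<gamma> 0) * real k + Q) * \<theta> k + sqrt (\<gamma> 0) * \<theta> k"
      unfolding th by (simp add: algebra_simps)
    also have "\<dots> \<le> Q + Q * \<alpha> k" using Suc inc by (rule add_mono)
    also have "\<dots> = (1 + \<alpha> k) * Q" by (simp add: algebra_simps)
    finally show ?case using al[of k] by (simp add: mult_le_cancel_left)
  qed (simp add: th0)
  moreover have "0 < sqrt (\<gamma> 0) * real k + Q" using ga0 Qpos by (simp add: add_nonneg_pos)
  ultimately show "\<theta> k \<le> Q / (sqrt (\<gamma> 0) * real k + Q)"
    by (simp add: pos_le_divide_eq mult.commute)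
  define c where "c = min m (\<gamma> 0)"
  have c0: "0 \<le> c" using m ga0 by (simp add: c_def)
  have bound: "(sqrt c * real k + Q) * sqrt (\<theta> k) \<le> Q"
  proof (induction k)
    case (Suc k)
    \<comment> \<open>The increment of \<open>1 / sqrt \<theta>\<close> is \<open>(t - 1) / sqrt (\<theta> k)\<close>, and \<open>(t - 1) (t + 1) = \<alpha> k\<close>.\<close>
    define t where "t = sqrt (1 + \<alpha> k)"
    have t: "1 \<le> t" "t\<^sup>2 = 1 + \<alpha> k" using al[of k] by (simp_all add: t_def)
    have tth: "t * sqrt (\<theta> (Suc k)) = sqrt (\<theta> k)"
      unfolding t_def real_sqrt_mult[symmetric] th ..
    have "(sqrt c * sqrt (\<theta> k))\<^sup>2 \<le> (q * \<alpha> k)\<^sup>2"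
      unfolding qa using galo[of k] thpos[of k] c0
      by (simp add: power_mult_distrib c_def mult_right_mono)
    then have lo: "sqrt c * sqrt (\<theta> k) \<le> q * \<alpha> k" using qa0 by (rule power2_le_imp_le)
    have "\<gamma> k * \<theta> k \<le> max m (\<gamma> 0) * 1"
      using gahi[of k] th1[of k] thpos[of k] m by (intro mult_mono) auto
    then have "(q * \<alpha> k)\<^sup>2 \<le> (sqrt (max m (\<gamma> 0)))\<^sup>2" unfolding qa using m by simp
    then have hi: "q * \<alpha> k \<le> sqrt (max m (\<gamma> 0))" by (rule power2_le_imp_le) (use m in auto)
    have "t \<le> t\<^sup>2" using t(1) by (simp add: power2_eq_square)
    then have "q * t \<le> q * (1 + \<alpha> k)" using q(1) t(2) by (intro mult_left_mono) auto
    with hi have qt: "q * (t + 1) \<le> Q" using q(1) unfolding Qq by (simp add: algebra_simps)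
    have "sqrt c * sqrt (\<theta> k) * (t + 1) \<le> q * \<alpha> k * (t + 1)"
      using lo t(1) by (intro mult_right_mono) auto
    also have "\<dots> \<le> Q * \<alpha> k" using mult_right_mono[OF qt, of "\<alpha> k"] al[of k] by (simp add: ac_simps)
    also have "\<dots> = Q * (t - 1) * (t + 1)"
      using t(2) by (simp add: algebra_simps power2_eq_square)
    finally have inc: "sqrt c * sqrt (\<theta> k) \<le> Q * (t - 1)"
      using t(1) by (simp add: mult_le_cancel_right)
    have "t * ((sqrt c * real (Suc k) + Q) * sqrt (\<theta> (Suc k)))
        = (sqrt c * real (Suc k) + Q) * (t * sqrt (\<theta> (Suc k)))"
      by (rule mult.left_commute)
    also have "\<dots> = (sqrt c * real k + Q) * sqrt (\<theta> k) + sqrt c * sqrt (\<theta> k)"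
      unfolding tth by (simp add: algebra_simps)
    also have "\<dots> \<le> Q + Q * (t - 1)" using Suc inc by (rule add_mono)
    also have "\<dots> = t * Q" by (simp add: algebra_simps)
    finally show ?case using t(1) by (simp add: mult_le_cancel_left)
  qed (simp add: th0)
  have pos: "0 < sqrt c * real k + Q" using c0 Qpos by (simp add: add_nonneg_pos)
  have "sqrt (\<theta> k) \<le> Q / (sqrt c * real k + Q)"
    using bound pos by (simp add: pos_le_divide_eq mult.commute)
  then have "(sqrt (\<theta> k))\<^sup>2 \<le> (Q / (sqrt c * real k + Q))\<^sup>2"
    using thpos[of k] by (intro power_mono) auto
  then show "\<theta> k \<le> Q\<^sup>2 / (sqrt (min m (\<gamma> 0)) * real k + Q)\<^sup>2"
    using thpos[of k] by (simp add: power_divide c_def)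
qed

section \<open>Convergence of the corrected explicit scheme\<close>

theorem theorem6p1:
  fixes X :: "(real^'n) set" and A :: "real^'n^'m" and b :: "real^'m"
    and h :: "real^'n \<Rightarrow> real" and g f :: "real^'n \<Rightarrow> ereal"
    and \<beta> \<mu> L :: real
    and xs :: "real^'n" and ls :: "real^'m"
    and \<theta> \<gamma> \<alpha> :: "nat \<Rightarrow> real"
    and x y v :: "nat \<Rightarrow> real^'n" and lam lamhat :: "nat \<Rightarrow> real^'m"
    and \<mu>\<beta> L\<beta> \<gamma>min \<gamma>max Q :: real
    and E :: "nat \<Rightarrow> ereal" and R0 :: ereal
  assumes X: "closed X" "convex X"
    and beta: "0 \<le> \<beta>"
    and mu_L: "0 \<le> \<mu>" "\<mu> \<le> L"
    and h: "h \<in> S11 \<mu> L X"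
    and g: "g \<in> S0 0 X"
  defines "f \<equiv> \<lambda>z. ereal (h z) + g z"
  assumes dom: "\<exists>z\<in>X. f z < \<infinity>"
    and feas: "b \<in> (\<lambda>z. A *v z) ` X"
    and kkt: "kkt_point X A b f xs ls"
  defines "\<mu>\<beta> \<equiv> mu_beta A \<mu> \<beta>"
    and "L\<beta> \<equiv> L_beta A L \<beta>"
  assumes init: "\<theta> 0 = 1" "\<gamma> 0 > 0" "x 0 \<in> X" "v 0 \<in> X"
    and alpha: "\<And>k. \<alpha> k > 0"
    and theta: "\<And>k. (\<theta> (Suc k) - \<theta> k) / \<alpha> k = - \<theta> (Suc k)"
    and gamma: "\<And>k. (\<gamma> (Suc k) - \<gamma> k) / \<alpha> k = \<mu>\<beta> - \<gamma> (Suc k)"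
  defines "lamhat \<equiv> \<lambda>k. lam k + (\<alpha> k / \<theta> k) *\<^sub>R (A *v v k - b)"
  assumes lam_step: "\<And>k. \<theta> k *\<^sub>R ((lam (Suc k) - lam k) /\<^sub>R \<alpha> k) = A *v v (Suc k) - b"
    and y_step: "\<And>k. (y k - x k) /\<^sub>R \<alpha> k = v k - y k"
    and v_step: "\<And>k. \<gamma> k *\<^sub>R ((v (Suc k) - v k) /\<^sub>R \<alpha> k) \<in>
        (\<lambda>s. \<mu>\<beta> *\<^sub>R (y k - v (Suc k)) - s) `
          ({grad (h_beta A b h \<beta>) (y k)} + subdiff g (v (Suc k)) + normal_cone X (v (Suc k))
            + {transpose A *v lamhat k})"
    and x_step: "\<And>k. (x (Suc k) - x k) /\<^sub>R \<alpha> k = v (Suc k) - x (Suc k)"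
  defines "E \<equiv> \<lambda>k. lagrangian X A b f \<beta> (x k) ls - lagrangian X A b f \<beta> xs (lam k)
        + ereal (\<gamma> k / 2 * (norm (v k - xs))\<^sup>2) + ereal (\<theta> k / 2 * (norm (lam k - ls))\<^sup>2)"
    and "R0 \<equiv> ereal_sqrt (2 * E 0) + ereal (norm (lam 0 - ls)) + ereal (norm (A *v x 0 - b))"
    and "\<gamma>min \<equiv> min \<mu>\<beta> (\<gamma> 0)"
    and "\<gamma>max \<equiv> max \<mu>\<beta> (\<gamma> 0)"
    and "Q \<equiv> 3 * sqrt (L\<beta> + (spectral_norm A)\<^sup>2) + sqrt \<gamma>max"
  shows "(\<forall>k. x k \<in> X \<and> y k \<in> X \<and> v k \<in> X) \<and>
    ((\<forall>k. (L\<beta> + (spectral_norm A)\<^sup>2) * (\<alpha> k)\<^sup>2 = \<gamma> k * \<theta> k) \<longrightarrow>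
      (\<forall>k. ereal (1 + \<alpha> k) * E (Suc k) \<le> E k) \<and>
      (\<forall>k. ereal (norm (A *v x k - b)) \<le> ereal (\<theta> k) * R0 \<and>
           0 \<le> lagrangian X A b f 0 (x k) ls - lagrangian X A b f 0 xs (lam k) \<and>
           lagrangian X A b f 0 (x k) ls - lagrangian X A b f 0 xs (lam k) \<le> ereal (\<theta> k) * E 0 \<and>
           \<bar>f (x k) - f xs\<bar> \<le> ereal (\<theta> k) * (E 0 + R0 * ereal (norm ls)) \<and>
           \<theta> k \<le> min (Q / (sqrt (\<gamma> 0) * real k + Q))
                       (Q\<^sup>2 / (sqrt \<gamma>min * real k + Q)\<^sup>2)))"
proof -
  define G where "G z = real_of_ereal (g z)" for z
  have g_fin: "g z = ereal (G z)" if "g z \<noteq> \<infinity>" for z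
    using that S0_not_minf[OF g, of z] by (cases "g z") (auto simp: G_def)
  have sub_fin: "g z \<noteq> \<infinity>" if "p \<in> subdiff g z" for p z
  proof -
    have "proper g" using g unfolding S0_def mem_Collect_eq by (elim conjE)
    then show ?thesis using that by (rule subdiff_finite)
  qed

  have xs: "xs \<in> X" "A *v xs = b" using kkt by (simp_all add: kkt_point_def)
  have saddle: "f xs \<le> f z + ereal (ls \<bullet> (A *v z - b))" if "z \<in> X" for z
    by (rule kkt_minimizes_lagrangian[OF kkt that])
  \<comment> \<open>Otherwise the saddle point inequality would make \<open>f\<close> infinite on all of \<open>X\<close>.\<close>
  have gxs: "g xs \<noteq> \<infinity>"
  proof
    assume "g xs = \<infinity>"
    obtain z where z: "z \<in> X" "f z < \<infinity>" using dom by blast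
    have "f xs \<le> f z + ereal (ls \<bullet> (A *v z - b))" by (rule saddle[OF z(1)])
    with z(2) \<open>g xs = \<infinity>\<close> show False by (simp add: f_def)
  qed

  have th: "(1 + \<alpha> k) * \<theta> (Suc k) = \<theta> k" for k
    using theta[of k] alpha[of k] by (simp add: field_simps)
  have ga: "(1 + \<alpha> k) * \<gamma> (Suc k) = \<gamma> k + \<alpha> k * \<mu>\<beta>" for k
    using gamma[of k] alpha[of k] by (simp add: field_simps)
  have mb: "0 \<le> \<mu>\<beta>"
    unfolding \<mu>\<beta>_def mu_beta_def using mu_L beta sigma_min_sq_rayleigh(1)[of A] by simp
  have Lb: "0 \<le> L\<beta>" unfolding L\<beta>_def L_beta_def using mu_L beta by simp
  have thpos: "0 < \<theta> k" and th1: "\<theta> k \<le> 1" for k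
    using theta_in_unit_interval[of \<theta> \<alpha>] init(1) alpha th by simp_all
  have gapos: "0 < \<gamma> k" for k
  proof (induction k)
    case (Suc k)
    have "0 \<le> \<alpha> k * \<mu>\<beta>" using alpha[of k] mb by simp
    with Suc ga[of k] have "0 < (1 + \<alpha> k) * \<gamma> (Suc k)" by simp
    then show ?case using alpha[of k] by (simp add: zero_less_mult_iff)
  qed (simp add: init)

  have cleared: "u - w = c *\<^sub>R s" if "(u - w) /\<^sub>R c = s" "0 < c" for u w s :: "real^'n" and c
    using that by auto
  have xr: "(1 + \<alpha> k) *\<^sub>R x (Suc k) = x k + \<alpha> k *\<^sub>R v (Suc k)" for k
    using cleared[OF x_step alpha, of k] by (simp add: algebra_simps)
  have yr: "(1 + \<alpha> k) *\<^sub>R y k = x k + \<alpha> k *\<^sub>R v k" for k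
    using cleared[OF y_step alpha, of k] by (simp add: algebra_simps)
  have lr: "\<theta> k *\<^sub>R (lam (Suc k) - lam k) = \<alpha> k *\<^sub>R (A *v v (Suc k) - b)" for k
    unfolding lam_step[of k, symmetric] using alpha[of k] by simp
  have vr: "\<exists>p n. p \<in> subdiff g (v (Suc k)) \<and> n \<in> normal_cone X (v (Suc k)) \<and>
      \<gamma> k *\<^sub>R (v (Suc k) - v k) = \<alpha> k *\<^sub>R (\<mu>\<beta> *\<^sub>R (y k - v (Suc k))
        - (grad (h_beta A b h \<beta>) (y k) + p + n + transpose A *v lamhat k))" for k
  proof -
    obtain p n where pn: "p \<in> subdiff g (v (Suc k))" "n \<in> normal_cone X (v (Suc k))"
      "\<gamma> k *\<^sub>R ((v (Suc k) - v k) /\<^sub>R \<alpha> k) = \<mu>\<beta> *\<^sub>R (y k - v (Suc k))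
        - (grad (h_beta A b h \<beta>) (y k) + p + n + transpose A *v lamhat k)"
      using v_step[of k] by (elim imageE set_plus_elim) auto
    have "\<gamma> k *\<^sub>R (v (Suc k) - v k) = \<alpha> k *\<^sub>R (\<gamma> k *\<^sub>R ((v (Suc k) - v k) /\<^sub>R \<alpha> k))"
      using alpha[of k] by simp
    then show ?thesis using pn(1,2) unfolding pn(3) by blast
  qed
  have v_in: "v k \<in> X" for k
  proof (cases k)
    case (Suc j)
    then show ?thesis using vr[of j] by (auto simp: normal_cone_def split: if_splits)
  qed (simp add: init)
  have x_in: "x k \<in> X" for k
  proof (induction k)
    case (Suc k)
    show ?case by (rule convex_step_in[OF X(2) alpha xr Suc v_in])
  qed (simp add: init)
  have y_in: "y k \<in> X" for k
    by (rule convex_step_in[OF X(2) alpha yr x_in v_in])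

  have lag_fin: "lagrangian X A b f \<rho> z l
      = ereal (h z + G z + \<rho> / 2 * (norm (A *v z - b))\<^sup>2 + l \<bullet> (A *v z - b))"
    if "z \<in> X" "g z \<noteq> \<infinity>" for \<rho> z l
    using that by (simp add: lagrangian_def f_beta_def ind_def f_def g_fin)
  have lag_inf: "lagrangian X A b f \<rho> z l = \<infinity>" if "z \<in> X" "g z = \<infinity>" for \<rho> z l
    using that by (simp add: lagrangian_def f_beta_def ind_def f_def)
  have lag_xs: "lagrangian X A b f \<rho> xs l = ereal (h xs + G xs)" for \<rho> l
    unfolding lag_fin[OF xs(1) gxs] xs(2) by simp
  have saddle_real: "h xs + G xs \<le> h z + G z + ls \<bullet> (A *v z - b)"
    if "z \<in> X" "g z \<noteq> \<infinity>" for z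
    using saddle[OF that(1)] g_fin[OF that(2)] g_fin[OF gxs] by (simp add: f_def)
  \<comment> \<open>The energy as a real number; it agrees with \<open>E\<close> as long as \<open>g\<close> is finite at \<open>x k\<close>.\<close>
  define e where "e k = h_beta A b h \<beta> (x k) + G (x k) + ls \<bullet> (A *v x k - b)
      - (h_beta A b h \<beta> xs + G xs)
      + \<gamma> k / 2 * (norm (v k - xs))\<^sup>2 + \<theta> k / 2 * (norm (lam k - ls))\<^sup>2" for k
  have E_fin: "E k = ereal (e k)" if "g (x k) \<noteq> \<infinity>" for k
    unfolding E_def lag_fin[OF x_in that] lag_xs e_def h_beta_def xs(2) by simp
  have E_inf: "E k = \<infinity>" if "g (x k) = \<infinity>" for k
    unfolding E_def lag_inf[OF x_in that] lag_xs by simp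

  have main: "(\<forall>k. ereal (1 + \<alpha> k) * E (Suc k) \<le> E k) \<and>
      (\<forall>k. ereal (norm (A *v x k - b)) \<le> ereal (\<theta> k) * R0 \<and>
           0 \<le> lagrangian X A b f 0 (x k) ls - lagrangian X A b f 0 xs (lam k) \<and>
           lagrangian X A b f 0 (x k) ls - lagrangian X A b f 0 xs (lam k) \<le> ereal (\<theta> k) * E 0 \<and>
           \<bar>f (x k) - f xs\<bar> \<le> ereal (\<theta> k) * (E 0 + R0 * ereal (norm ls)) \<and>
           \<theta> k \<le> min (Q / (sqrt (\<gamma> 0) * real k + Q))
                       (Q\<^sup>2 / (sqrt \<gamma>min * real k + Q)\<^sup>2))"
    if size: "\<forall>k. (L\<beta> + (spectral_norm A)\<^sup>2) * (\<alpha> k)\<^sup>2 = \<gamma> k * \<theta> k"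
  proof -
    have step: "g (x (Suc k)) \<noteq> \<infinity> \<and> (1 + \<alpha> k) * e (Suc k) \<le> e k" if gx: "g (x k) \<noteq> \<infinity>" for k
    proof -
      obtain p n where p: "p \<in> subdiff g (v (Suc k))" and n: "n \<in> normal_cone X (v (Suc k))"
        and veq: "\<gamma> k *\<^sub>R (v (Suc k) - v k) = \<alpha> k *\<^sub>R (\<mu>\<beta> *\<^sub>R (y k - v (Suc k))
        - (grad (h_beta A b h \<beta>) (y k) + p + n + transpose A *v lamhat k))"
        using vr[of k] by blast
      have gv: "g (v (Suc k)) \<noteq> \<infinity>" by (rule sub_fin[OF p])
      have gle: "g (x (Suc k)) \<le> ereal ((G (x k) + \<alpha> k * G (v (Suc k))) / (1 + \<alpha> k))"
        by (rule S0_convex_step[OF g alpha xr]) (simp_all add: g_fin gx gv)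
      then have gx': "g (x (Suc k)) \<noteq> \<infinity>" by auto
      have conv: "(1 + \<alpha> k) * G (x (Suc k)) \<le> G (x k) + \<alpha> k * G (v (Suc k))"
        using gle alpha[of k] unfolding g_fin[OF gx'] by (simp add: pos_le_divide_eq mult.commute)
      have "g (v (Suc k)) + ereal (p \<bullet> (xs - v (Suc k))) \<le> g xs"
        using p by (simp add: subdiff_def)
      then have sub: "G (v (Suc k)) + p \<bullet> (xs - v (Suc k)) \<le> G xs"
        unfolding g_fin[OF gv] g_fin[OF gxs] by simp
      have cone: "n \<bullet> (xs - v (Suc k)) \<le> 0"
        using n xs(1) by (auto simp: normal_cone_def split: if_splits)
      have low: "h_beta A b h \<beta> (y k) + grad (h_beta A b h \<beta>) (y k) \<bullet> (z - y k)
            + \<mu>\<beta> / 2 * (norm (z - y k))\<^sup>2 \<le> h_beta A b h \<beta> z" if "z \<in> X" for z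
        unfolding \<mu>\<beta>_def by (rule h_beta_strong_convexity[OF h beta y_in that])
      have "(1 + \<alpha> k) * e (Suc k) \<le> e k"
        unfolding e_def
      proof (rule lyapunov_contraction[where A = A and K = "spectral_norm A" and b = b and y = "y k"
            and m = \<mu>\<beta> and M = L\<beta> and d = "grad (h_beta A b h \<beta>) (y k)" and p = p and n = n])
        show "\<gamma> k *\<^sub>R (v (Suc k) - v k) = \<alpha> k *\<^sub>R (\<mu>\<beta> *\<^sub>R (y k - v (Suc k))
            - (grad (h_beta A b h \<beta>) (y k) + p + n
               + transpose A *v (lam k + (\<alpha> k / \<theta> k) *\<^sub>R (A *v v k - b))))"
          using veq unfolding lamhat_def .
        show "h_beta A b h \<beta> (x (Suc k)) \<le> h_beta A b h \<beta> (y k)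
            + grad (h_beta A b h \<beta>) (y k) \<bullet> (x (Suc k) - y k) + L\<beta> / 2 * (norm (x (Suc k) - y k))\<^sup>2"
          unfolding L\<beta>_def by (rule h_beta_descent[OF h X(2) beta y_in x_in])
      qed (fact alpha thpos th1 mb Lb spectral_norm_bound spec[OF size, of k] xs th ga yr xr lr
          low[OF x_in] low[OF xs(1)] conv sub cone)+
      with gx' show ?thesis by simp
    qed
    have decay: "ereal (1 + \<alpha> k) * E (Suc k) \<le> E k" for k
    proof (cases "g (x k) = \<infinity>")
      case False
      from step[OF this] show ?thesis by (simp add: E_fin False)
    qed (simp add: E_inf)
    have gap0: "0 \<le> lagrangian X A b f 0 (x k) ls - lagrangian X A b f 0 xs (lam k)" for k
    proof (cases "g (x k) = \<infinity>")
      case False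
      show ?thesis
        unfolding lag_xs lag_fin[OF x_in False] using saddle_real[OF x_in False] by simp
    qed (simp add: lag_inf[OF x_in] lag_xs)
    have rates: "\<theta> k \<le> min (Q / (sqrt (\<gamma> 0) * real k + Q)) (Q\<^sup>2 / (sqrt \<gamma>min * real k + Q)\<^sup>2)" for k
      using theta_decay[OF init(1,2) mb alpha th ga spec[OF size], of Q k]
      unfolding Q_def \<gamma>max_def \<gamma>min_def by simp
    have bounds: "ereal (norm (A *v x k - b)) \<le> ereal (\<theta> k) * R0 \<and>
       lagrangian X A b f 0 (x k) ls - lagrangian X A b f 0 xs (lam k) \<le> ereal (\<theta> k) * E 0 \<and>
       \<bar>f (x k) - f xs\<bar> \<le> ereal (\<theta> k) * (E 0 + R0 * ereal (norm ls))" for k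
    proof (cases "g (x 0) = \<infinity>")
      case True
      \<comment> \<open>All three right-hand sides are infinite because \<open>\<theta> k > 0\<close>; in the last one \<open>\<infinity> * 0 = 0\<close> does
        no harm as \<open>E 0\<close> is added.\<close>
      have E0: "E 0 = \<infinity>" by (rule E_inf[OF True])
      have R0: "R0 = \<infinity>" unfolding R0_def E0 by (simp add: ereal_sqrt_def)
      have "E 0 + R0 * ereal (norm ls) = \<infinity>" unfolding E0 R0 by simp
      with thpos[of k] show ?thesis unfolding E0 R0 by simp
    next
      case False
      have gfin: "g (x k) \<noteq> \<infinity>" for k
        by (induction k) (use False step in auto)
      have e_bound: "e k \<le> \<theta> k * e 0" for k
      proof (induction k)
        case (Suc k)
        have "(1 + \<alpha> k) * e (Suc k) \<le> e k" using step[OF gfin] by blast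
        also have "\<dots> \<le> \<theta> k * e 0" by (rule Suc)
        also have "\<dots> = (1 + \<alpha> k) * (\<theta> (Suc k) * e 0)" by (simp only: th[of k, symmetric] mult.assoc)
        finally show ?case using alpha[of k] by (simp add: mult_le_cancel_left)
      qed (simp add: init)
      define gap where "gap = h (x k) + G (x k) + ls \<bullet> (A *v x k - b) - (h xs + G xs)"
      have gap_nonneg: "0 \<le> gap" using saddle_real[OF x_in gfin, of k] by (simp add: gap_def)
      have parts: "e k = gap + \<beta> / 2 * (norm (A *v x k - b))\<^sup>2
          + \<gamma> k / 2 * (norm (v k - xs))\<^sup>2 + \<theta> k / 2 * (norm (lam k - ls))\<^sup>2"
        by (simp add: e_def gap_def h_beta_def xs(2))
      have nn: "0 \<le> \<beta> / 2 * (norm (A *v x k - b))\<^sup>2" "0 \<le> \<gamma> k / 2 * (norm (v k - xs))\<^sup>2"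
        "0 \<le> \<theta> k / 2 * (norm (lam k - ls))\<^sup>2"
        using beta gapos[of k] thpos[of k] by simp_all
      have gap_le: "gap \<le> \<theta> k * e 0" using parts nn e_bound[of k] by linarith
      have "\<theta> k * ((norm (lam k - ls))\<^sup>2 / 2) \<le> \<theta> k * e 0"
        using parts nn gap_nonneg e_bound[of k] by simp
      then have lam_sq: "(norm (lam k - ls))\<^sup>2 \<le> 2 * e 0" using thpos[of k] by simp
      then have lam_le: "norm (lam k - ls) \<le> sqrt (2 * e 0)" by (rule real_le_rsqrt)
      define r where "r = sqrt (2 * e 0) + norm (lam 0 - ls) + norm (A *v x 0 - b)"
      have E0: "E 0 = ereal (e 0)" by (rule E_fin[OF False])
      have R0: "R0 = ereal r" unfolding R0_def E0 r_def by (simp add: ereal_sqrt_def)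
      have "norm (lam k - lam 0 + (A *v x 0 - b))
          \<le> norm (lam k - ls) + norm (lam 0 - ls) + norm (A *v x 0 - b)"
      proof -
        have "lam k - lam 0 + (A *v x 0 - b) = (lam k - ls) - (lam 0 - ls) + (A *v x 0 - b)" by simp
        then show ?thesis
          using norm_triangle_ineq[of "(lam k - ls) - (lam 0 - ls)" "A *v x 0 - b"]
            norm_triangle_ineq4[of "lam k - ls" "lam 0 - ls"] by simp
      qed
      then have "norm (lam k - lam 0 + (A *v x 0 - b)) \<le> r" using lam_le by (simp add: r_def)
      then have res: "norm (A *v x k - b) \<le> \<theta> k * r"
        unfolding residual_dual_identity[OF init(1) alpha th xr lr, of k]
        using thpos[of k] by (simp add: abs_of_pos)
      have "\<bar>ls \<bullet> (A *v x k - b)\<bar> \<le> norm ls * norm (A *v x k - b)" by (rule Cauchy_Schwarz_ineq2)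
      also have "\<dots> \<le> norm ls * (\<theta> k * r)" using res by (rule mult_left_mono) simp
      finally have cs: "\<bar>ls \<bullet> (A *v x k - b)\<bar> \<le> \<theta> k * (r * norm ls)" by (simp add: ac_simps)
      have "\<bar>(h (x k) + G (x k)) - (h xs + G xs)\<bar> \<le> \<theta> k * (e 0 + r * norm ls)"
        using gap_nonneg gap_le cs unfolding gap_def distrib_left by linarith
      moreover have "f (x k) - f xs = ereal ((h (x k) + G (x k)) - (h xs + G xs))"
        unfolding f_def g_fin[OF gfin] g_fin[OF gxs] by simp
      moreover have "lagrangian X A b f 0 (x k) ls - lagrangian X A b f 0 xs (lam k) = ereal gap"
        unfolding lag_xs lag_fin[OF x_in gfin] gap_def by simp
      ultimately show ?thesis using res gap_le unfolding E0 R0 by simp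
    qed
    show ?thesis
      by (intro conjI allI; rule decay gap0 rates bounds[THEN conjunct1]
          bounds[THEN conjunct2, THEN conjunct1] bounds[THEN conjunct2, THEN conjunct2])
  qed
  have "x k \<in> X \<and> y k \<in> X \<and> v k \<in> X" for k by (intro conjI x_in y_in v_in)
  then show ?thesis by (rule conjI[OF allI impI[OF main]])
qed

end
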